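(* Let $n\ge1$, $K=\lfloor (n-1)/2\rfloor$, let $f:\{0,\ldots,K\}\to[0,\infty)$ be nonincreasing with $Z=\sum_{w\in S_n}f(v(w))>0$, and let $W$ be a random permutation with $$\mathbb P_f(W=w)=\frac{f(v(w))}{Z},\qquad w\in S_n .$$ For every history $h=(w_1,\ldots,w_k)$, $0\le k<n$, of positive probability (i.e. $\mathbb P_f(W_1=w_1,\ldots,W_k=w_k)>0$) with remaining set $R=[n]\setminus\{w_1,\ldots,w_k\}$, let $p_h(c)=\mathbb P_f(W_{k+1}=c\mid W_1=w_1,\ldots,W_k=w_k)$ be the conditional probability that the next card is $c$ (for the empty history, $p_h(c)=\mathbb P_f(W_1=c)$). Then, for every such $h$, the direction-tracking strategy $G$ satisfies $$G(h)\in\operatorname*{arg\,max}_{c\in R}p_h(c),$$ and $$\mathbb E_f C_G=\max_{A\in\mathcal A_n}\mathbb E_f C_A .$$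
   Context: Write $[n]=\{1,\ldots,n\}$ and let $S_n$ be the set of permutations $w=(w_1,\ldots,w_n)$ of $[n]$. The valley count of $w\in S_n$ is $v(w)=\#\{i: 2\le i\le n-1,\ w_{i-1}>w_i<w_{i+1}\}$ (first and last positions are not counted); one always has $0\le v(w)\le K=\lfloor (n-1)/2\rfloor$. Complete feedback. In round $j$ ($1\le j\le n$) the player guesses $W_j$ using the previously revealed cards $W_1,\ldots,W_{j-1}$, and is then shown $W_j$ whether or not the guess was correct. $\mathcal A_n$ is the class of all complete-feedback strategies: the guess $A_j\in[n]$ in round $j$ is a function of $(W_1,\ldots,W_{j-1})$ and possibly of an auxiliary random variable $U$ independent of $W$ (deterministic strategies are included; cards may be guessed repeatedly). The number of correct guesses is $C_A=\sum_{j=1}^n\mathbf 1_{\{A_j=W_j\}}$, and $\mathbb E_f$ is the expectation when $W$ has law $\mathbb P_f$. Direction-tracking strategy $G$. A history of length $k<n$ is a sequence $h=(w_1,\ldots,w_k)$ of distinct elements of $[n]$, and $R=[n]\setminus\{w_1,\ldots,w_k\}$. Let $G(h)$ denote the guess in round $k+1$ after $h$. For the empty history, $G(\varnothing)=1$. For $k\ge1$ put $L=w_k$, $R_-=\{r\in R: r<L\}$, $R_+=\{r\in R: r>L\}$. The current direction is upward if $k=1$; for $k\ge2$ it is upward if $w_{k-1}<w_k$ and downward if $w_{k-1}>w_k$. Then - if upward: $G(h)=\min R_+$ if $R_+\neq\varnothing$, and $G(h)=\max R_-$ if $R_+=\varnothing$; - if downward: $G(h)=\max R_-$ if $R_-\neq\varnothing$,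 and $G(h)=\min R_+$ if $R_-=\varnothing$. *)

theory Defs
  imports "HOL-Probability.Probability" "HOL-Combinatorics.Multiset_Permutations"
begin

text \<open>
  A permutation \<open>w\<close> of \<open>{1..n}\<close> is its word \<open>[w\<^sub>1, ..., w\<^sub>n]\<close>, that is, an element of
  \<^term>\<open>permutations_of_set {1..n}\<close>. List positions are counted from \<open>0\<close>, so \<open>w\<^sub>i\<close> is \<open>w ! (i - 1)\<close>
  and the history preceding round \<open>k + 1\<close> is \<open>take k w\<close>.
\<close>

definition valleys :: "nat list \<Rightarrow> nat" where
  "valleys w = card {i. 0 < i \<and> Suc i < length w \<and> w ! (i - 1) > w ! i \<and> w ! i < w ! Suc i}"

definition histories :: "nat \<Rightarrow> nat list set" where
  "histories n = {h. distinct h \<and> set h \<subseteq> {1..n} \<and> length h < n}"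

definition remaining :: "nat \<Rightarrow> nat list \<Rightarrow> nat set" where
  "remaining n h = {1..n} - set h"

definition upward :: "nat list \<Rightarrow> bool" where
  "upward h \<longleftrightarrow> length h = 1 \<or> (length h \<ge> 2 \<and> h ! (length h - 2) < h ! (length h - 1))"

definition direction_tracking :: "nat \<Rightarrow> nat list \<Rightarrow> nat" where
  "direction_tracking n h =
     (if h = [] then 1
      else
        let L = last h;
            R_minus = {r \<in> remaining n h. r < L};
            R_plus = {r \<in> remaining n h. r > L}
        in if upward h
           then (if R_plus \<noteq> {} then Min R_plus else Max R_minus)
           else (if R_minus \<noteq> {} then Max R_minus else Min R_plus))"

text \<open>
  \<^const>\<open>prob_space.indep_var\<close> needs both variables to take values in the same type; this is the
  same notion with two target types.
\<close>

definition independent_variables ::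
    "'a measure \<Rightarrow> 'b measure \<Rightarrow> ('a \<Rightarrow> 'b) \<Rightarrow> 'c measure \<Rightarrow> ('a \<Rightarrow> 'c) \<Rightarrow> bool" where
  "independent_variables M S X T Y \<longleftrightarrow>
     X \<in> M \<rightarrow>\<^sub>M S \<and> Y \<in> M \<rightarrow>\<^sub>M T \<and>
     prob_space.indep_set M {X -` B \<inter> space M | B. B \<in> sets S} {Y -` B \<inter> space M | B. B \<in> sets T}"

text \<open>
  A strategy \<open>A\<close> assigns to a history \<open>h\<close> the random guess \<open>A h :: 'a \<Rightarrow> nat\<close> made after \<open>h\<close>; the
  round is determined by \<open>length h\<close>. It must have the form \<open>A h \<omega> = a h (U \<omega>)\<close> for some random
  variable \<open>U\<close> independent of the deck \<open>W\<close>. HOL cannot quantify existentially over the type in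
  which \<open>U\<close> takes its values, so that type is a parameter, while the measurable space \<open>N\<close> on it is
  existentially quantified. A constant \<open>U\<close> gives the deterministic strategies.
\<close>

definition complete_feedback_strategies ::
    "'u itself \<Rightarrow> nat \<Rightarrow> 'a measure \<Rightarrow> ('a \<Rightarrow> nat list) \<Rightarrow> (nat list \<Rightarrow> 'a \<Rightarrow> nat) set" where
  "complete_feedback_strategies _ n M W =
     {A. \<exists>(N :: 'u measure) U a.
           independent_variables M (count_space (permutations_of_set {1..n})) W N U \<and>
           (\<forall>h\<in>histories n. a h \<in> N \<rightarrow>\<^sub>M count_space {1..n}) \<and>
           (\<forall>h\<in>histories n. \<forall>\<omega>\<in>space M. A h \<omega> = a h (U \<omega>))}"

definition correct_guesses ::
    "nat \<Rightarrow> ('a \<Rightarrow> nat list) \<Rightarrow> (nat list \<Rightarrow> 'a \<Rightarrow> nat) \<Rightarrow> 'a \<Rightarrow> real" where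
  "correct_guesses n W A \<omega> = (\<Sum>k<n. of_bool (A (take k (W \<omega>)) \<omega> = W \<omega> ! k))"

end

theory Submission imports Defs begin

text \<open>
  Given a history, the number of valleys that a continuation adds depends only on the current
  direction, the last card \<open>L\<close> and the remaining set \<open>R\<close>, and its distribution over all orderings
  of \<open>R\<close> depends on \<open>L\<close> and \<open>R\<close> only through \<open>m = card R\<close> and the number \<open>a\<close> of remaining
  cards below \<open>L\<close>. Fix an antimonotone \<open>F\<close> and write \<open>U\<^sub>m(a)\<close> and \<open>D\<^sub>m(a)\<close> for the sum of
  \<open>F\<close> over the added valleys of all continuations, when the direction is upward and downward
  (\<open>rank_weight m F up a\<close> below). Classifying continuations by the rank \<open>j\<close> of the
  next card, which becomes the number of cards below the new last card, gives

  \<^item> \<open>U\<^sub>m\<^sub>+\<^sub>1(a) = (\<Sum>j<a. D\<^sub>m(j)) + (\<Sum>a\<le>j\<le>m. U\<^sub>m(j))\<close>;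
  \<^item> \<open>D\<^sub>m\<^sub>+\<^sub>1(a) = (\<Sum>j<a. D\<^sub>m(j)) + (\<Sum>a\<le>j\<le>m. U'\<^sub>m(j))\<close>,

  where \<open>U'\<close> is \<open>U\<close> formed with \<open>F \<circ> Suc\<close>, because turning from down to up completes a valley.
  Comparing these sums term by term yields \<open>U' \<le> D \<le> U\<close> at equal arguments. Moving \<open>a\<close> by
  one exchanges a single term \<open>D\<^sub>m(a)\<close> for \<open>U\<^sub>m(a)\<close> or \<open>U'\<^sub>m(a)\<close>, so \<open>U\<close> decreases and \<open>D\<close>
  increases in \<open>a\<close>. These four comparisons say exactly that the best next card is the nearest one
  in the current direction, or the nearest one behind if none is left ahead
  (\<open>tracking_guess_optimal\<close>): the direction-tracking guess.

  For the expected score, write the number of correct guesses as a sum over histories. As the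
  auxiliary variable is independent of the deck, the contribution of a history is an average, with
  weights of total mass at most one, of the probabilities that this history occurs and is followed
  by a given card. Hence it never exceeds the largest of them, and a guess that
  maximizes these probabilities after every history maximizes the expectation
  (\<open>expected_correct_guesses_le\<close>).
\<close>

section \<open>Valleys created by a continuation\<close>

fun added_valleys :: "bool \<Rightarrow> nat \<Rightarrow> nat list \<Rightarrow> nat" where
  "added_valleys up L [] = 0"
| "added_valleys up L (c # u) = of_bool (\<not> up \<and> L < c) + added_valleys (L < c) c u"

text \<open>
  The empty history is treated as one that climbs from a fictitious card \<open>0\<close>. Then the first real
  card is always a step up, it never creates a valley, and the opening guess \<open>1\<close> is the
  smallest card above \<open>0\<close>, so that the empty history is not a special case.
\<close>

definition heading_up :: "nat list \<Rightarrow> bool" where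
  "heading_up h \<longleftrightarrow> h = [] \<or> upward h"

definition last_card :: "nat list \<Rightarrow> nat" where
  "last_card h = (if h = [] then 0 else last h)"

lemma heading_up_snoc:
  assumes "distinct (h @ [c])" "c > 0"
  shows "heading_up (h @ [c]) \<longleftrightarrow> last_card h < c"
proof (cases h rule: rev_cases)
  case (snoc g x)
  then show ?thesis by (auto simp: heading_up_def upward_def last_card_def nth_append)
qed (use assms in \<open>auto simp: heading_up_def upward_def last_card_def\<close>)

text \<open>
  The two ends of a word are never valleys, so appending a card changes the status of the previously
  last position only.
\<close>

lemma valleys_snoc:
  assumes d: "distinct (h @ [c])" and c: "c > 0"
  shows "valleys (h @ [c]) = valleys h + of_bool (\<not> heading_up h \<and> last_card h < c)"
proof -
  define V where "V = {i. 0 < i \<and> Suc i < length h \<and> h ! (i - 1) > h ! i \<and> h ! i < h ! Suc i}"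
  define B where "B = {i. i = length h - 1 \<and> \<not> heading_up h \<and> last_card h < c}"
  \<comment> \<open>Distinctness turns the failure of an ascent into a descent.\<close>
  have down: "\<not> heading_up h \<longleftrightarrow> length h \<ge> 2 \<and> h ! (length h - 2) > h ! (length h - 1)"
  proof (cases "length h \<ge> 2")
    case True
    have "h ! (length h - 2) \<noteq> h ! (length h - 1)"
      using d True by (subst nth_eq_iff_index_eq) auto
    then show ?thesis using True by (auto simp: heading_up_def upward_def)
  next
    case False
    then have "h = [] \<or> length h = 1" by (cases h) (auto simp: Suc_le_eq)
    then show ?thesis using False by (auto simp: heading_up_def upward_def)
  qed
  have "{i. 0 < i \<and> Suc i < length (h @ [c]) \<and> (h @ [c]) ! (i - 1) > (h @ [c]) ! i \<and>
            (h @ [c]) ! i < (h @ [c]) ! Suc i} = V \<union> B" (is "?S = _")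
  proof (intro set_eqI)
    fix i
    consider "Suc i < length h" | "Suc i = length h" | "Suc i > length h" by linarith
    then show "i \<in> ?S \<longleftrightarrow> i \<in> V \<union> B"
    proof cases
      case 1
      then show ?thesis by (auto simp: V_def B_def nth_append)
    next
      case 2
      then have i: "i = length h - 1" "h \<noteq> []" by auto
      then have "last_card h = h ! i" by (simp add: last_card_def last_conv_nth)
      moreover have "i - 1 = length h - 2" "0 < i \<longleftrightarrow> length h \<ge> 2" using 2 by auto
      ultimately show ?thesis using 2 i by (auto simp: V_def B_def nth_append down)
    next
      case 3
      then show ?thesis by (auto simp: V_def B_def down)
    qed
  qed
  then have "valleys (h @ [c]) = card (V \<union> B)" unfolding valleys_def by simp
  also have "\<dots> = card V + card B"
  proof (rule card_Un_disjoint)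
    show "finite V" by (rule finite_subset[of _ "{..length h}"]) (auto simp: V_def)
  qed (auto simp: V_def B_def down)
  also have "card B = of_bool (\<not> heading_up h \<and> last_card h < c)"
    by (auto simp: B_def)
  finally show ?thesis by (simp add: V_def valleys_def)
qed

lemma valleys_append:
  assumes "distinct (h @ u)" "0 \<notin> set u"
  shows "valleys (h @ u) = valleys h + added_valleys (heading_up h) (last_card h) u"
  using assms
proof (induction u arbitrary: h)
  case (Cons c u)
  have *: "valleys ((h @ [c]) @ u) =
      valleys (h @ [c]) + added_valleys (heading_up (h @ [c])) (last_card (h @ [c])) u"
    using Cons.prems by (intro Cons.IH) auto
  have "distinct (h @ [c])" "c > 0" using Cons.prems by auto
  with * show ?case
    by (simp add: valleys_snoc heading_up_snoc) (simp add: last_card_def)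
qed simp

lemma added_valleys_le: "added_valleys up L u \<le> (length u + of_bool (\<not> up)) div 2"
proof (induction u arbitrary: up L)
  case (Cons c u)
  have "added_valleys (L < c) c u \<le> (length u + of_bool (\<not> L < c)) div 2" by (rule Cons.IH)
  then show ?case by (cases up; cases "L < c") auto
qed simp

text \<open>
  The first card always counts as a step up, and from an upward state each valley uses up two further
  cards. The bound keeps the argument of the weight function inside the range where it is
  known to be nonincreasing.
\<close>

lemma valleys_le:
  assumes "distinct w" "0 \<notin> set w"
  shows "valleys w \<le> (length w - 1) div 2"
proof (cases w)
  case (Cons c u)
  have "valleys ([] @ w) = valleys [] + added_valleys True 0 w"
    using assms valleys_append[of "[]" w] by (simp add: heading_up_def last_card_def)
  then show ?thesis using Cons added_valleys_le[of True c u] assms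
    by (simp add: valleys_def)
qed (simp add: valleys_def)

section \<open>Total weight of the continuations\<close>

definition completion_weight :: "(nat \<Rightarrow> real) \<Rightarrow> bool \<Rightarrow> nat \<Rightarrow> nat set \<Rightarrow> real" where
  "completion_weight F up L R = (\<Sum>u\<in>permutations_of_set R. F (added_valleys up L u))"

text \<open>
  The weight \<^const>\<open>completion_weight\<close> in terms of ranks alone: \<open>m\<close> cards remain and \<open>a\<close> of them lie
  below the last card. After a next card of rank \<open>j\<close>, exactly \<open>j\<close> of the other remaining
  cards lie below it.
\<close>

primrec rank_weight :: "nat \<Rightarrow> (nat \<Rightarrow> real) \<Rightarrow> bool \<Rightarrow> nat \<Rightarrow> real" where
  "rank_weight 0 F up a = F 0"
| "rank_weight (Suc m) F up a =
     (\<Sum>j\<le>m. if j < a then rank_weight m F False j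
             else rank_weight m (if up then F else F \<circ> Suc) True j)"

definition rank_in :: "nat set \<Rightarrow> nat \<Rightarrow> nat" where
  "rank_in R c = card {r \<in> R. r < c}"

lemma rank_in_mono: "finite R \<Longrightarrow> c \<le> d \<Longrightarrow> rank_in R c \<le> rank_in R d"
  unfolding rank_in_def by (intro card_mono) auto

lemma rank_in_less: "finite R \<Longrightarrow> c \<in> R \<Longrightarrow> c < d \<Longrightarrow> rank_in R c < rank_in R d"
  unfolding rank_in_def by (intro psubset_card_mono) auto

lemma rank_in_bij:
  assumes "finite R"
  shows "bij_betw (rank_in R) R {..<card R}"
proof -
  have inj: "inj_on (rank_in R) R"
    by (metis assms inj_onI less_irrefl linorder_neqE_nat rank_in_less)
  have "rank_in R ` R \<subseteq> {..<card R}"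
    using assms by (auto simp: rank_in_def intro!: psubset_card_mono)
  moreover have "card (rank_in R ` R) = card {..<card R}" using inj by (simp add: card_image)
  ultimately have "rank_in R ` R = {..<card R}" by (intro card_subset_eq) auto
  with inj show ?thesis by (simp add: bij_betw_def)
qed

lemma rank_in_remove: "rank_in (R - {c}) c = rank_in R c"
  unfolding rank_in_def by (rule arg_cong[where f = card]) auto

lemma completion_weight_step:
  assumes "R \<noteq> {}" "finite R"
  shows "completion_weight F up L R =
    (\<Sum>c\<in>R. completion_weight (if \<not> up \<and> L < c then F \<circ> Suc else F) (L < c) c (R - {c}))"
proof -
  have "completion_weight F up L R =
      (\<Sum>u\<in>(\<Union>c\<in>R. (#) c ` permutations_of_set (R - {c})). F (added_valleys up L u))"
    using assms by (simp add: completion_weight_def permutations_of_set_nonempty)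
  also have "\<dots> = (\<Sum>c\<in>R. \<Sum>u\<in>(#) c ` permutations_of_set (R - {c}). F (added_valleys up L u))"
    using assms by (intro sum.UNION_disjoint) auto
  also have "\<dots> = (\<Sum>c\<in>R. completion_weight (if \<not> up \<and> L < c then F \<circ> Suc else F) (L < c) c (R - {c}))"
    by (intro sum.cong refl) (auto simp: sum.reindex completion_weight_def)
  finally show ?thesis .
qed

text \<open>
  Ranks identify the remaining cards with an initial segment of the naturals, and the identification
  is compatible with drawing a card. Passing to ranks makes states with different remaining sets
  comparable, as happens for two candidates for the same round.
\<close>

lemma completion_weight_eq_rank_weight:
  assumes "finite R" "L \<notin> R"
  shows "completion_weight F up L R = rank_weight (card R) F up (rank_in R L)"
  using assms
proof (induction "card R" arbitrary: R F up L)
  case 0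
  then have "R = {}" by simp
  then show ?case by (simp add: completion_weight_def)
next
  case (Suc m)
  have ne: "R \<noteq> {}" using Suc.hyps(2) by auto
  let ?t = "\<lambda>j. if j < rank_in R L then rank_weight m F False j
                 else rank_weight m (if up then F else F \<circ> Suc) True j"
  have "completion_weight F up L R =
    (\<Sum>c\<in>R. completion_weight (if \<not> up \<and> L < c then F \<circ> Suc else F) (L < c) c (R - {c}))"
    using ne Suc.prems by (intro completion_weight_step)
  also have "\<dots> = (\<Sum>c\<in>R. ?t (rank_in R c))"
  proof (intro sum.cong refl)
    fix c assume c: "c \<in> R"
    have "completion_weight (if \<not> up \<and> L < c then F \<circ> Suc else F) (L < c) c (R - {c}) =
        rank_weight m (if \<not> up \<and> L < c then F \<circ> Suc else F) (L < c) (rank_in R c)"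
      using Suc.hyps(1)[of "R - {c}" c] Suc.hyps(2)[symmetric] Suc.prems c by (simp add: rank_in_remove)
    \<comment> \<open>The side of \<open>L\<close> on which \<open>c\<close> lies is visible in its rank.\<close>
    moreover have "L < c \<longleftrightarrow> \<not> rank_in R c < rank_in R L"
      using rank_in_less[OF Suc.prems(1) c, of L] rank_in_mono[OF Suc.prems(1), of L c] c Suc.prems
      by (metis leD leI linorder_neqE_nat order_less_imp_le)
    ultimately show "completion_weight (if \<not> up \<and> L < c then F \<circ> Suc else F) (L < c) c (R - {c})
        = ?t (rank_in R c)" by auto
  qed
  also have "\<dots> = (\<Sum>j<card R. ?t j)"
    by (intro sum.reindex_bij_betw rank_in_bij Suc.prems)
  also have "\<dots> = rank_weight (card R) F up (rank_in R L)"
    unfolding Suc.hyps(2)[symmetric] by (simp add: lessThan_Suc_atMost)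
  finally show ?case .
qed

section \<open>Comparison of states\<close>

lemma rank_weight_mono:
  "(\<And>i. F i \<le> G i) \<Longrightarrow> rank_weight m F up a \<le> rank_weight m G up a"
  by (induction m arbitrary: F G up a) (auto intro!: sum_mono)

text \<open>
  The two recursions differ only in the terms for cards above the last one, where the downward state
  pays for one more valley.
\<close>

lemma rank_weight_down_le_up:
  assumes "antimono F"
  shows "rank_weight m F False a \<le> rank_weight m F True a"
  using assms by (cases m) (auto intro!: sum_mono rank_weight_mono simp: antimono_def)

text \<open>
  Conversely, paying for one valley at once is no better than being in the downward state: the terms
  for cards above the last one agree, and for the others \<open>F \<circ> Suc \<le> F\<close>.
\<close>

lemma rank_weight_Suc_up_le_down:
  assumes "antimono F"
  shows "rank_weight m (F \<circ> Suc) True a \<le> rank_weight m F False a"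
  using assms by (cases m) (auto intro!: sum_mono rank_weight_mono simp: antimono_def)

text \<open>
  Enlarging \<open>a\<close> replaces upward terms by downward terms of the same rank, which are no larger.
\<close>

lemma rank_weight_up_antimono:
  assumes "antimono F" "a \<le> b"
  shows "rank_weight m F True b \<le> rank_weight m F True a"
  using assms by (cases m) (auto intro!: sum_mono rank_weight_down_le_up)

text \<open>
  Here enlarging \<open>a\<close> replaces upward terms that pay for a valley by downward terms of the same
  rank, which are no smaller.
\<close>

lemma rank_weight_down_mono:
  assumes "antimono F" "a \<le> b"
  shows "rank_weight m F False a \<le> rank_weight m F False b"
  using assms by (cases m) (auto intro!: sum_mono rank_weight_Suc_up_le_down[unfolded comp_def] simp: comp_def)

text \<open>
  The rule of \<^const>\<open>direction_tracking\<close> as a function of the state; with the fictitious card \<open>0\<close> it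
  also covers the opening guess.
\<close>

definition tracking_guess :: "bool \<Rightarrow> nat \<Rightarrow> nat set \<Rightarrow> nat" where
  "tracking_guess up L R =
     (let R_minus = {r \<in> R. r < L}; R_plus = {r \<in> R. r > L}
      in if up then (if R_plus \<noteq> {} then Min R_plus else Max R_minus)
         else (if R_minus \<noteq> {} then Max R_minus else Min R_plus))"

text \<open>
  The guess is the nearest card ahead when there is one, and otherwise all remaining cards lie behind
  and it is the nearest of those. Which of the two happens can be read off from the side of \<open>L\<close> on
  which the guess lies.
\<close>

lemma tracking_guess_cases:
  fixes up :: bool
  assumes "finite R" "R \<noteq> {}" "L \<notin> R"
  defines "g \<equiv> tracking_guess up L R"
  shows "g \<in> R"
    and "up \<Longrightarrow> L < g \<Longrightarrow> (\<And>c. c \<in> R \<Longrightarrow> L < c \<Longrightarrow> g \<le> c)"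
    and "up \<Longrightarrow> g < L \<Longrightarrow> (\<And>c. c \<in> R \<Longrightarrow> c \<le> g)"
    and "\<not> up \<Longrightarrow> g < L \<Longrightarrow> (\<And>c. c \<in> R \<Longrightarrow> c < L \<Longrightarrow> c \<le> g)"
    and "\<not> up \<Longrightarrow> L < g \<Longrightarrow> (\<And>c. c \<in> R \<Longrightarrow> g \<le> c)"
proof -
  let ?M = "{r \<in> R. r < L}" and ?P = "{r \<in> R. r > L}"
  have fin: "finite ?M" "finite ?P" using assms by auto
  have U: "x \<in> ?M \<or> x \<in> ?P" if "x \<in> R" for x
    using that \<open>L \<notin> R\<close> by (cases x L rule: linorder_cases) auto
  have M: "?M \<noteq> {} \<Longrightarrow> Max ?M \<in> ?M" "\<And>c. c \<in> ?M \<Longrightarrow> c \<le> Max ?M"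
    using Max_in[OF fin(1)] Max_ge[OF fin(1)] by blast+
  have P: "?P \<noteq> {} \<Longrightarrow> Min ?P \<in> ?P" "\<And>c. c \<in> ?P \<Longrightarrow> Min ?P \<le> c"
    using Min_in[OF fin(2)] Min_le[OF fin(2)] by blast+
  have g: "g = (if up then (if ?P \<noteq> {} then Min ?P else Max ?M)
         else (if ?M \<noteq> {} then Max ?M else Min ?P))"
    by (simp add: g_def tracking_guess_def Let_def)
  have ne: "?M \<noteq> {} \<or> ?P \<noteq> {}" using U \<open>R \<noteq> {}\<close> by blast
  show "g \<in> R" using M(1) P(1) ne unfolding g by (auto split: if_splits)
  show "g \<le> c" if "up" "L < g" "c \<in> R" "L < c" for c
  proof -
    have "c \<in> ?P" using that by simp
    then show ?thesis using \<open>up\<close> P(2)[of c] unfolding g by auto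
  qed
  show "c \<le> g" if "up" "g < L" "c \<in> R" for c
  proof -
    have "?P = {}"
    proof (rule ccontr)
      assume "?P \<noteq> {}"
      then have "L < g" using P(1) \<open>up\<close> unfolding g by simp
      then show False using \<open>g < L\<close> by simp
    qed
    then have "c \<in> ?M" "g = Max ?M" using U[OF \<open>c \<in> R\<close>] \<open>up\<close> unfolding g by auto
    then show ?thesis using M(2) by simp
  qed
  show "c \<le> g" if "\<not> up" "g < L" "c \<in> R" "c < L" for c
  proof -
    have "c \<in> ?M" using that by simp
    then show ?thesis using \<open>\<not> up\<close> M(2)[of c] unfolding g by auto
  qed
  show "g \<le> c" if "\<not> up" "L < g" "c \<in> R" for c
  proof -
    have "?M = {}"
    proof (rule ccontr)
      assume "?M \<noteq> {}"
      then have "g < L" using M(1) \<open>\<not> up\<close> unfolding g by simp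
      then show False using \<open>L < g\<close> by simp
    qed
    then have "c \<in> ?P" "g = Min ?P" using U[OF \<open>c \<in> R\<close>] \<open>\<not> up\<close> unfolding g by auto
    then show ?thesis using P(2) by simp
  qed
qed

text \<open>
  Among candidates on the same side of \<open>L\<close>, the monotonicity of the rank weights favours the one
  nearest to \<open>L\<close>. A candidate behind is compared with the guess ahead in two moves:
  to the rank of the guess along its own side, and then across sides at equal rank.
\<close>

lemma tracking_guess_optimal:
  fixes up :: bool
  assumes R: "finite R" "L \<notin> R" and c: "c \<in> R" and F: "antimono F"
  defines "V \<equiv> \<lambda>c. completion_weight (if \<not> up \<and> L < c then F \<circ> Suc else F) (L < c) c (R - {c})"
  shows "V c \<le> V (tracking_guess up L R)"
proof -
  define g where "g = tracking_guess up L R"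
  define m where "m = card R - 1"
  have ne: "R \<noteq> {}" using c by auto
  note tg = tracking_guess_cases[OF R(1) ne R(2), where up = up, folded g_def]
  have V: "V x = rank_weight m (if \<not> up \<and> L < x then F \<circ> Suc else F) (L < x) (rank_in R x)"
    if "x \<in> R" for x
    using R that by (simp add: V_def m_def completion_weight_eq_rank_weight rank_in_remove)
  have F': "antimono (F \<circ> Suc)" using F by (auto simp: antimono_def)
  have rk: "rank_in R x \<le> rank_in R y" if "x \<le> y" for x y
    using R(1) that by (rule rank_in_mono)
  have nc: "c \<noteq> L" "g \<noteq> L" using c tg(1) R by auto
  have "V c \<le> V g"
  proof (cases up)
    case True
    show ?thesis
    proof (cases "L < g")
      case g: True
      show ?thesis
      proof (cases "L < c")
        case True
        then show ?thesis using \<open>up\<close> g c tg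
          by (simp add: V rank_weight_up_antimono F rk)
      next
        case False
        then have "rank_in R c \<le> rank_in R g" using g by (intro rk) auto
        then have "rank_weight m F False (rank_in R c) \<le> rank_weight m F True (rank_in R g)"
          using rank_weight_down_mono[OF F] rank_weight_down_le_up[OF F] order_trans by blast
        then show ?thesis using \<open>up\<close> g c tg False by (simp add: V)
      qed
    next
      case False
      then have "g < L" using nc by simp
      then show ?thesis using \<open>up\<close> c tg(1) tg(3)[OF \<open>up\<close> \<open>g < L\<close> c]
        by (simp add: V rank_weight_down_mono F rk)
    qed
  next
    case False
    show ?thesis
    proof (cases "L < g")
      case g: True
      have "g \<le> c" using tg(5) False g c by blast
      then show ?thesis using False g c tg(1)
        by (simp add: V rank_weight_up_antimono F' rk)
    next
      case g: False
      show ?thesis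
      proof (cases "L < c")
        case True
        then have "rank_in R g \<le> rank_in R c" using g by (intro rk) auto
        then have "rank_weight m (F \<circ> Suc) True (rank_in R c) \<le> rank_weight m F False (rank_in R g)"
          using rank_weight_up_antimono[OF F'] rank_weight_Suc_up_le_down[OF F] order_trans by blast
        then show ?thesis using False g c tg(1) True by (simp add: V)
      next
        case cL: False
        have "c \<le> g" using tg(4) False g c cL nc by auto
        then show ?thesis using False g c tg(1) cL
          by (simp add: V rank_weight_down_mono F rk)
      qed
    qed
  qed
  then show ?thesis by (simp add: g_def)
qed

section \<open>The next card\<close>

lemma direction_tracking_eq:
  assumes "n \<ge> 1"
  shows "direction_tracking n h = tracking_guess (heading_up h) (last_card h) (remaining n h)"
proof (cases "h = []")
  case True
  have "{r \<in> remaining n []. r > 0} = {1..n}" by (auto simp: remaining_def)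
  moreover have "Min {1..n} = 1" using assms by (intro Min_eqI) auto
  ultimately show ?thesis using True assms
    by (simp add: direction_tracking_def tracking_guess_def heading_up_def last_card_def)
qed (simp add: direction_tracking_def tracking_guess_def heading_up_def last_card_def Let_def)

lemma finite_remaining: "finite (remaining n h)"
  by (simp add: remaining_def)

lemma last_card_notin_remaining: "last_card h \<notin> remaining n h"
  by (auto simp: remaining_def last_card_def)

lemma remaining_nonempty: "h \<in> histories n \<Longrightarrow> remaining n h \<noteq> {}"
proof
  assume h: "h \<in> histories n" and "remaining n h = {}"
  then have "{1..n} \<subseteq> set h" by (auto simp: remaining_def)
  then have "card {1..n} \<le> card (set h)" by (intro card_mono) auto
  then show False using h by (simp add: histories_def distinct_card)
qed

lemma direction_tracking_in_remaining:
  assumes "n \<ge> 1" "h \<in> histories n"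
  shows "direction_tracking n h \<in> remaining n h"
  unfolding direction_tracking_eq[OF assms(1)]
  by (intro tracking_guess_cases finite_remaining remaining_nonempty last_card_notin_remaining assms)

lemma sum_over_next_card:
  assumes h: "h \<in> histories n" and c: "c \<in> remaining n h"
  shows "(\<Sum>w | w \<in> permutations_of_set {1..n} \<and> w ! length h = c \<and> take (length h) w = h. g w)
    = (\<Sum>u\<in>permutations_of_set (remaining n h - {c}). g (h @ c # u))"
proof (rule sum.reindex_bij_witness[where j = "drop (Suc (length h))" and i = "\<lambda>u. h @ c # u"])
  fix w assume w: "w \<in> {w \<in> permutations_of_set {1..n}. w ! length h = c \<and> take (length h) w = h}"
  then have d: "distinct w" "set w = {1..n}" by (auto simp: permutations_of_set_def)
  then have "length w = n" by (metis card_atLeastAtMost diff_Suc_1 distinct_card)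
  then have lt: "length h < length w" using h by (simp add: histories_def)
  have eq: "w = h @ c # drop (Suc (length h)) w"
    using id_take_nth_drop[OF lt] w by simp
  then show "h @ c # drop (Suc (length h)) w = w" by simp
  show "drop (Suc (length h)) w \<in> permutations_of_set (remaining n h - {c})"
  proof -
    define u where "u = drop (Suc (length h)) w"
    have e: "w = h @ c # u" using eq by (simp add: u_def)
    have "distinct (h @ c # u)" "set (h @ c # u) = {1..n}" using d unfolding e by auto
    then show ?thesis unfolding u_def[symmetric]
      by (auto simp: permutations_of_set_def remaining_def)
  qed
  show "g (h @ c # drop (Suc (length h)) w) = g w" using eq by simp
next
  fix u assume u: "u \<in> permutations_of_set (remaining n h - {c})"
  show "drop (Suc (length h)) (h @ c # u) = u" by simp
  show "h @ c # u \<in> {w \<in> permutations_of_set {1..n}. w ! length h = c \<and> take (length h) w = h}"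
    using u h c by (auto simp: permutations_of_set_def remaining_def histories_def)
qed

lemma weight_of_next_card:
  fixes F :: "nat \<Rightarrow> real"
  assumes h: "h \<in> histories n" and c: "c \<in> remaining n h"
  shows "(\<Sum>w | w \<in> permutations_of_set {1..n} \<and> w ! length h = c \<and> take (length h) w = h.
            F (valleys w))
    = completion_weight
        (if \<not> heading_up h \<and> last_card h < c then (\<lambda>i. F (valleys h + i)) \<circ> Suc
         else (\<lambda>i. F (valleys h + i)))
        (last_card h < c) c (remaining n h - {c})"
proof -
  have "F (valleys (h @ c # u)) = (if \<not> heading_up h \<and> last_card h < c
         then (\<lambda>i. F (valleys h + i)) \<circ> Suc else (\<lambda>i. F (valleys h + i)))
        (added_valleys (last_card h < c) c u)"
    if "u \<in> permutations_of_set (remaining n h - {c})" for u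
  proof -
    have "distinct (h @ c # u)" "0 \<notin> set (c # u)"
      using that h c by (auto simp: permutations_of_set_def remaining_def histories_def)
    from valleys_append[OF this] show ?thesis by (simp add: add_ac)
  qed
  then show ?thesis unfolding sum_over_next_card[OF assms] completion_weight_def
    by (intro sum.cong) auto
qed

text \<open>
  The valleys already present in \<open>h\<close> shift the argument of \<open>F\<close> by a constant, which preserves
  antimonotonicity; so the comparison of states applies after every history.
\<close>

lemma direction_tracking_maximizes_weight:
  fixes F :: "nat \<Rightarrow> real"
  assumes n: "n \<ge> 1" and h: "h \<in> histories n" and F: "antimono F" and c: "c \<in> remaining n h"
  shows "(\<Sum>w | w \<in> permutations_of_set {1..n} \<and> w ! length h = c \<and>
              take (length h) w = h. F (valleys w))
    \<le> (\<Sum>w | w \<in> permutations_of_set {1..n} \<and> w ! length h = direction_tracking n h \<and>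
              take (length h) w = h. F (valleys w))"
proof -
  have F': "antimono (\<lambda>i. F (valleys h + i))" using F by (auto simp: antimono_def)
  show ?thesis
    unfolding weight_of_next_card[OF h c]
      weight_of_next_card[OF h direction_tracking_in_remaining[OF n h]]
    unfolding direction_tracking_eq[OF n]
    by (rule tracking_guess_optimal[OF finite_remaining last_card_notin_remaining c F'])
qed

section \<open>From pointwise optimality to the expected score\<close>

lemma finite_histories: "finite (histories n)"
proof (rule finite_subset)
  show "histories n \<subseteq> {xs. set xs \<subseteq> {1..n} \<and> length xs \<le> n}"
    by (auto simp: histories_def)
qed (simp add: finite_lists_length_le)

lemma take_in_histories:
  assumes "w \<in> permutations_of_set {1..n}" "k < n"
  shows "take k w \<in> histories n" "length w = n"
proof -
  have d: "distinct w" "set w = {1..n}" using assms by (auto simp: permutations_of_set_def)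
  then show l: "length w = n" by (metis card_atLeastAtMost diff_Suc_1 distinct_card)
  show "take k w \<in> histories n"
    using d l assms by (auto simp: histories_def dest: in_set_takeD)
qed

text \<open>
  Exactly one history of each length is a prefix of the deck. Summing over all histories instead of
  over rounds makes the index set independent of the random deck.
\<close>

lemma correct_guesses_eq_sum_histories:
  assumes W: "W \<omega> \<in> permutations_of_set {1..n}"
  shows "correct_guesses n W A \<omega> =
    (\<Sum>h\<in>histories n. of_bool (take (length h) (W \<omega>) = h \<and> A h \<omega> = W \<omega> ! length h))"
proof -
  let ?w = "W \<omega>"
  have len: "length (take k ?w) = k" if "k < n" for k
    using take_in_histories[OF W that] that by simp
  have "(\<Sum>h\<in>histories n. of_bool (take (length h) ?w = h \<and> A h \<omega> = ?w ! length h) :: real)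
     = (\<Sum>h\<in>(\<lambda>k. take k ?w) ` {..<n}. of_bool (take (length h) ?w = h \<and> A h \<omega> = ?w ! length h))"
  proof (intro sum.mono_neutral_right finite_histories ballI)
    show "(\<lambda>k. take k ?w) ` {..<n} \<subseteq> histories n" using take_in_histories(1)[OF W] by auto
    fix h assume "h \<in> histories n - (\<lambda>k. take k ?w) ` {..<n}"
    then have "length h < n" and h: "h \<notin> (\<lambda>k. take k ?w) ` {..<n}"
      by (simp_all add: histories_def)
    then have "take (length h) ?w \<in> (\<lambda>k. take k ?w) ` {..<n}" by simp
    with h have "take (length h) ?w \<noteq> h" by metis
    then show "(of_bool (take (length h) ?w = h \<and> A h \<omega> = ?w ! length h) :: real) = 0" by simp
  qed
  also have "\<dots> = (\<Sum>k<n. of_bool (A (take k ?w) \<omega> = ?w ! k))"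
  proof (subst sum.reindex)
    show "inj_on (\<lambda>k. take k ?w) {..<n}" 
      by (rule inj_on_inverseI[where g = length]) (simp add: len del: length_take)
  qed (rule sum.cong; simp add: len del: length_take)
  finally show ?thesis by (simp add: correct_guesses_def)
qed

lemma expected_correct_guesses:
  assumes M: "prob_space M" and W: "W \<in> M \<rightarrow>\<^sub>M count_space (permutations_of_set {1..n})"
    and meas: "\<And>h. h \<in> histories n \<Longrightarrow>
      {\<omega> \<in> space M. take (length h) (W \<omega>) = h \<and> A h \<omega> = W \<omega> ! length h} \<in> sets M"
  shows "integral\<^sup>L M (correct_guesses n W A) =
    (\<Sum>h\<in>histories n. \<P>(\<omega> in M. take (length h) (W \<omega>) = h \<and> A h \<omega> = W \<omega> ! length h))"
proof -
  interpret prob_space M by fact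
  let ?E = "\<lambda>h. {\<omega> \<in> space M. take (length h) (W \<omega>) = h \<and> A h \<omega> = W \<omega> ! length h}"
  have W': "W \<omega> \<in> permutations_of_set {1..n}" if "\<omega> \<in> space M" for \<omega>
    using measurable_space[OF W that] by simp
  have "integral\<^sup>L M (correct_guesses n W A) = (\<integral>\<omega>. (\<Sum>h\<in>histories n. indicator (?E h) \<omega>) \<partial>M)"
  proof (intro Bochner_Integration.integral_cong refl)
    fix \<omega> assume "\<omega> \<in> space M"
    then show "correct_guesses n W A \<omega> = (\<Sum>h\<in>histories n. indicator (?E h) \<omega>)"
      using correct_guesses_eq_sum_histories[where W = W and \<omega> = \<omega>, OF W']
      by (simp add: indicator_def)
  qed
  also have "\<dots> = (\<Sum>h\<in>histories n. \<integral>\<omega>. indicator (?E h) \<omega> \<partial>M)"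
    using meas by (intro Bochner_Integration.integral_sum)
      (auto simp: integrable_indicator_iff emeasure_eq_measure)
  also have "\<dots> = (\<Sum>h\<in>histories n. prob (?E h))"
    using meas by (intro sum.cong refl) (simp add: Int_absorb1)
  finally show ?thesis .
qed

lemma deck_event_measurable:
  assumes "W \<in> M \<rightarrow>\<^sub>M count_space S"
  shows "{\<omega> \<in> space M. P (W \<omega>)} \<in> sets M"
proof -
  have "W -` {w \<in> S. P w} \<inter> space M \<in> sets M" using assms by (rule measurable_sets) auto
  also have "W -` {w \<in> S. P w} \<inter> space M = {\<omega> \<in> space M. P (W \<omega>)}"
    using measurable_space[OF assms] by auto
  finally show ?thesis .
qed

text \<open>
  For a fixed history, the event of a correct guess splits according to the guessed card, and
  independence turns each probability into a product. Bounding the deck factor by its maximum leaves the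
  total probability of the guesses, which is at most one.
\<close>

lemma expected_correct_guesses_le:
  assumes M: "prob_space M" and W: "W \<in> M \<rightarrow>\<^sub>M count_space (permutations_of_set {1..n})"
    and A: "A \<in> complete_feedback_strategies TYPE('u) n M W"
    and best: "\<And>h c. h \<in> histories n \<Longrightarrow> c \<in> {1..n} \<Longrightarrow>
      \<P>(\<omega> in M. W \<omega> ! length h = c \<and> take (length h) (W \<omega>) = h)
      \<le> \<P>(\<omega> in M. W \<omega> ! length h = g h \<and> take (length h) (W \<omega>) = h)"
  shows "integral\<^sup>L M (correct_guesses n W A) \<le> integral\<^sup>L M (correct_guesses n W (\<lambda>h \<omega>. g h))"
proof -
  interpret prob_space M by fact
  let ?P = "permutations_of_set {1..n}"
  obtain N :: "'u measure" and U a where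
    ind: "independent_variables M (count_space ?P) W N U"
    and a: "\<And>h. h \<in> histories n \<Longrightarrow> a h \<in> N \<rightarrow>\<^sub>M count_space {1..n}"
    and Aa: "\<And>h \<omega>. h \<in> histories n \<Longrightarrow> \<omega> \<in> space M \<Longrightarrow> A h \<omega> = a h (U \<omega>)"
    using A unfolding complete_feedback_strategies_def by blast
  have U: "U \<in> M \<rightarrow>\<^sub>M N" using ind by (simp add: independent_variables_def)
  have aU: "(\<lambda>\<omega>. a h (U \<omega>)) \<in> M \<rightarrow>\<^sub>M count_space {1..n}" if "h \<in> histories n" for h
    using measurable_compose[OF U a[OF that]] .
  let ?J = "\<lambda>h c. {\<omega> \<in> space M. W \<omega> ! length h = c \<and> take (length h) (W \<omega>) = h}"
  let ?B = "\<lambda>h c. {\<omega> \<in> space M. a h (U \<omega>) = c}"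
  have J: "?J h c \<in> sets M" for h c by (rule deck_event_measurable[OF W])
  have B: "?B h c \<in> sets M" if "h \<in> histories n" for h c
    using deck_event_measurable[OF aU[OF that], of "\<lambda>x. x = c"] .
  have indep: "prob (?J h c \<inter> ?B h c) = prob (?J h c) * prob (?B h c)" if h: "h \<in> histories n" for h c
  proof (rule indep_setD)
    show "indep_set {W -` B \<inter> space M |B. B \<in> sets (count_space ?P)} {U -` B \<inter> space M |B. B \<in> sets N}"
      using ind by (simp add: independent_variables_def)
    show "?J h c \<in> {W -` B \<inter> space M |B. B \<in> sets (count_space ?P)}"
      using measurable_space[OF W]
      by (intro CollectI exI[of _ "{w \<in> ?P. w ! length h = c \<and> take (length h) w = h}"]) auto
    have "?B h c = U -` {x \<in> space N. a h x = c} \<inter> space M"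
      using measurable_space[OF U] by auto
    moreover have "{x \<in> space N. a h x = c} \<in> sets N"
      using deck_event_measurable[OF a[OF h], of "\<lambda>x. x = c"] .
    ultimately show "?B h c \<in> {U -` B \<inter> space M |B. B \<in> sets N}" by blast
  qed
  have split: "{\<omega> \<in> space M. take (length h) (W \<omega>) = h \<and> A h \<omega> = W \<omega> ! length h}
      = (\<Union>c\<in>{1..n}. ?J h c \<inter> ?B h c)" if h: "h \<in> histories n" for h
  proof -
    have "a h (U \<omega>) \<in> {1..n}" if "\<omega> \<in> space M" for \<omega>
      using measurable_space[OF aU[OF h] that] by simp
    then show ?thesis by (force simp: Aa[OF h])
  qed
  have meas: "{\<omega> \<in> space M. take (length h) (W \<omega>) = h \<and> A h \<omega> = W \<omega> ! length h} \<in> sets M"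
    if h: "h \<in> histories n" for h
    unfolding split[OF h] using J B[OF h] by (intro sets.finite_UN) auto
  have "integral\<^sup>L M (correct_guesses n W A) =
      (\<Sum>h\<in>histories n. \<P>(\<omega> in M. take (length h) (W \<omega>) = h \<and> A h \<omega> = W \<omega> ! length h))"
    by (rule expected_correct_guesses[OF M W meas])
  also have "\<dots> \<le> (\<Sum>h\<in>histories n. \<P>(\<omega> in M. take (length h) (W \<omega>) = h \<and> g h = W \<omega> ! length h))"
  proof (rule sum_mono)
    fix h assume h: "h \<in> histories n"
    have "\<P>(\<omega> in M. take (length h) (W \<omega>) = h \<and> A h \<omega> = W \<omega> ! length h) =
        (\<Sum>c\<in>{1..n}. prob (?J h c \<inter> ?B h c))"
      unfolding split[OF h] using J B[OF h]
      by (intro finite_measure_finite_Union) (auto simp: disjoint_family_on_def)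
    also have "\<dots> \<le> (\<Sum>c\<in>{1..n}. prob (?J h (g h)) * prob (?B h c))"
      by (intro sum_mono) (auto simp: indep[OF h] intro!: mult_right_mono best[OF h])
    also have "\<dots> = prob (?J h (g h)) * prob (\<Union>c\<in>{1..n}. ?B h c)"
      unfolding sum_distrib_left[symmetric] using B[OF h]
      by (subst finite_measure_finite_Union) (auto simp: disjoint_family_on_def)
    also have "\<dots> \<le> prob (?J h (g h))"
      by (intro mult_left_le) auto
    also have "?J h (g h) = {\<omega> \<in> space M. take (length h) (W \<omega>) = h \<and> g h = W \<omega> ! length h}"
      by auto
    finally show "\<P>(\<omega> in M. take (length h) (W \<omega>) = h \<and> A h \<omega> = W \<omega> ! length h)
        \<le> \<P>(\<omega> in M. take (length h) (W \<omega>) = h \<and> g h = W \<omega> ! length h)" .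
  qed
  also have "\<dots> = integral\<^sup>L M (correct_guesses n W (\<lambda>h \<omega>. g h))"
    by (rule expected_correct_guesses[OF M W, symmetric]) (rule deck_event_measurable[OF W])
  finally show ?thesis .
qed

text \<open>
  A constant auxiliary variable generates only the trivial events, which are independent of everything.
\<close>

lemma deterministic_strategy:
  assumes M: "prob_space M" and W: "W \<in> M \<rightarrow>\<^sub>M count_space (permutations_of_set {1..n})"
    and g: "\<And>h. h \<in> histories n \<Longrightarrow> g h \<in> {1..n}"
  shows "(\<lambda>h \<omega>. g h) \<in> complete_feedback_strategies TYPE('u) n M W"
proof -
  interpret prob_space M by fact
  let ?N = "count_space UNIV :: 'u measure"
  have "independent_variables M (count_space (permutations_of_set {1..n})) W ?N (\<lambda>_. undefined)"
    unfolding independent_variables_def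
  proof (intro conjI W)
    show "indep_set {W -` B \<inter> space M |B. B \<in> sets (count_space (permutations_of_set {1..n}))}
        {(\<lambda>_. undefined) -` B \<inter> space M |B. B \<in> sets ?N}"
      using measurable_sets[OF W] prob_space
      by (intro indep_setI) (auto simp: vimage_const)
  qed simp
  then show ?thesis unfolding complete_feedback_strategies_def
    using g by (intro CollectI exI[of _ ?N] exI[of _ "\<lambda>_. undefined"] exI[of _ "\<lambda>h _. g h"]) auto
qed

theorem theorem2p1:
  fixes n K :: nat and f :: "nat \<Rightarrow> real" and Z :: real
    and M :: "'a measure" and W :: "'a \<Rightarrow> nat list"
  assumes n: "n \<ge> 1" and K: "K = (n - 1) div 2"
    and f_nonneg: "\<And>i. i \<in> {0..K} \<Longrightarrow> f i \<ge> 0"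
    and f_noninc: "antimono_on {0..K} f"
    and Z: "Z = (\<Sum>w\<in>permutations_of_set {1..n}. f (valleys w))" and Z_pos: "Z > 0"
    and M: "prob_space M"
    and W: "W \<in> M \<rightarrow>\<^sub>M count_space (permutations_of_set {1..n})"
    and law: "\<And>w. w \<in> permutations_of_set {1..n} \<Longrightarrow>
                \<P>(\<omega> in M. W \<omega> = w) = f (valleys w) / Z"
  shows "(\<forall>h\<in>histories n. \<P>(\<omega> in M. take (length h) (W \<omega>) = h) > 0 \<longrightarrow>
            is_arg_max
              (\<lambda>c. \<P>(\<omega> in M. W \<omega> ! length h = c \<bar> take (length h) (W \<omega>) = h))
              (\<lambda>c. c \<in> remaining n h)
              (direction_tracking n h)) \<and>
         is_arg_max
           (\<lambda>A. integral\<^sup>L M (correct_guesses n W A))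
           (\<lambda>A. A \<in> complete_feedback_strategies TYPE('u) n M W)
           (\<lambda>h \<omega>. direction_tracking n h)"
proof -
  interpret prob_space M by (rule M)
  let ?P = "permutations_of_set {1..n}"
  \<comment> \<open>The monotonicity of \<open>f\<close> is known only up to \<open>K\<close>; freezing it beyond gives an antimonotone
      function that agrees with \<open>f\<close> on all valley counts.\<close>
  define F where "F i = f (min i K)" for i
  have F: "antimono F"
    using f_noninc by (auto simp: antimono_def monotone_on_def F_def)
  have Ff: "F (valleys w) = f (valleys w)" if "w \<in> ?P" for w
  proof -
    have "distinct w" "set w = {1..n}" using that by (auto simp: permutations_of_set_def)
    then have "valleys w \<le> K"
      using valleys_le[of w] K distinct_card[of w] by simp
    then show ?thesis by (simp add: F_def min_absorb1)
  qed
  have prob_eq: "\<P>(\<omega> in M. Q (W \<omega>)) = (\<Sum>w | w \<in> ?P \<and> Q w. F (valleys w)) / Z" for Q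
  proof -
    have "{\<omega> \<in> space M. Q (W \<omega>)} = (\<Union>w\<in>{w \<in> ?P. Q w}. {\<omega> \<in> space M. W \<omega> = w})"
      using measurable_space[OF W] by auto
    also have "prob \<dots> = (\<Sum>w | w \<in> ?P \<and> Q w. \<P>(\<omega> in M. W \<omega> = w))"
      using deck_event_measurable[OF W]
      by (intro finite_measure_finite_Union) (auto simp: disjoint_family_on_def)
    also have "\<dots> = (\<Sum>w | w \<in> ?P \<and> Q w. F (valleys w) / Z)"
      by (intro sum.cong refl) (auto simp: law Ff)
    finally show ?thesis by (simp add: sum_divide_distrib)
  qed
  let ?J = "\<lambda>h c. \<P>(\<omega> in M. W \<omega> ! length h = c \<and> take (length h) (W \<omega>) = h)"
  \<comment> \<open>For joint probabilities the comparison covers histories of probability zero and cards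
      already drawn, as the sum over histories and guesses requires.\<close>
  have best: "?J h c \<le> ?J h (direction_tracking n h)" if h: "h \<in> histories n" for h c
  proof (cases "c \<in> remaining n h")
    case True
    show ?thesis
      using direction_tracking_maximizes_weight[OF n h F True] Z_pos
      unfolding prob_eq[of "\<lambda>w. w ! length h = c \<and> take (length h) w = h" for c]
      by (intro divide_right_mono) auto
  next
    case False
    have "{\<omega> \<in> space M. W \<omega> ! length h = c \<and> take (length h) (W \<omega>) = h} = {}"
    proof (intro equals0I, clarsimp)
      fix \<omega> assume \<omega>: "\<omega> \<in> space M" "take (length h) (W \<omega>) = h" "c = W \<omega> ! length h"
      then have w: "W \<omega> \<in> ?P" using measurable_space[OF W] by auto
      have k: "length h < length (W \<omega>)"
        using h take_in_histories(2)[OF w, of 0] n by (simp add: histories_def)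
      have "W \<omega> = h @ c # drop (Suc (length h)) (W \<omega>)"
        using id_take_nth_drop[OF k] \<omega> by simp
      moreover have "distinct (W \<omega>)" "set (W \<omega>) = {1..n}"
        using w by (auto simp: permutations_of_set_def)
      ultimately have "c \<in> {1..n}" "c \<notin> set h"
        by (metis in_set_conv_decomp, metis IntI distinct_append empty_iff list.set_intros(1))
      then show False using False by (simp add: remaining_def)
    qed
    then show ?thesis by (simp only: measure_empty measure_nonneg)
  qed
  have G: "direction_tracking n h \<in> remaining n h" if "h \<in> histories n" for h
    using n that by (rule direction_tracking_in_remaining)
  have arg_max_next: "is_arg_max
      (\<lambda>c. \<P>(\<omega> in M. W \<omega> ! length h = c \<bar> take (length h) (W \<omega>) = h))
      (\<lambda>c. c \<in> remaining n h) (direction_tracking n h)" if h: "h \<in> histories n" for h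
    using best[OF h] G[OF h]
    by (auto simp: is_arg_max_def cond_prob_def not_less intro!: divide_right_mono)
  have "(\<lambda>h \<omega>. direction_tracking n h) \<in> complete_feedback_strategies TYPE('u) n M W"
    using G by (intro deterministic_strategy[OF M W]) (auto simp: remaining_def)
  moreover have "integral\<^sup>L M (correct_guesses n W A)
      \<le> integral\<^sup>L M (correct_guesses n W (\<lambda>h \<omega>. direction_tracking n h))"
    if "A \<in> complete_feedback_strategies TYPE('u) n M W" for A
    by (rule expected_correct_guesses_le[OF M W that best])
  ultimately show ?thesis using arg_max_next by (auto simp: is_arg_max_def not_less)
qed

end
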